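(* Let $\overline{y}\in[0,\infty)$ be the optimal retirement boundary of the dual optimal stopping problem, i.e. a number such that for every $y>0$ the stopping time $\tau=\inf\{s\ge 0: y_s\le \overline{y}\}$ attains the supremum in $$\tilde w(y)=\sup_{\tau}\mathbb{E}^{y}\left[\int_0^{\tau}e^{-\beta s}\left(\underline{U}(y_s)-\overline{U}(y_s)+Yy_s\right)ds\right],$$ where the supremum is over all stopping times $\tau$ with values in $[0,\infty]$. Then $\overline{y}=0$ (i.e. the agent never retires) if and only if $$Y\ \ge\ \frac{1-\alpha}{\alpha}\,(\overline{L}-\underline{L}).$$
   Context: Constants: $r>0$, $\mu>r$, $\sigma>0$, $\theta:=(\mu-r)/\sigma>0$, $\beta>0$, $\alpha\in(0,1)$, $\gamma^*>0$, $\gamma:=\alpha\gamma^*$, $Y>0$ (labor income), $0<\underline{L}<\overline{L}$ (leisure before and after retirement). $(B_t)_{t\ge0}$ is a standard Brownian motion on a filtered probability space satisfying the usual conditions; stopping times refer to this filtration. $A(l):=e^{-\gamma^*(1-\alpha)l}$, so $A(\overline{L})<A(\underline{L})$. For $y>0$, $$\overline{U}(y):=\sup_{c\ge0}\left(-\tfrac{e^{-\gamma c}}{\gamma}A(\overline{L})-cy\right),\qquad \underline{U}(y):=\sup_{c\ge0}\left(-\tfrac{e^{-\gamma c}}{\gamma}A(\underline{L})-cy\right).$$ The dual process is $y_t=y\,e^{(\beta-r-\theta^2/2)t-\theta B_t}$, and $\mathbb{E}^y$ denotes expectation when $y_0=y$. Convention: $\inf\emptyset=\infty$, so $\overline{y}=0$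 corresponds to $\tau=\infty$. *)

theory Defs
  imports "HOL-Probability.Probability"
begin

text \<open>
  Time is indexed by \<^typ>\<open>ennreal\<close>, so that \<^const>\<open>filtration\<close> and \<^const>\<open>stopping_time\<close> apply
  verbatim to stopping times with values in \<open>[0, \<infinity>]\<close>. The member \<open>F \<infinity>\<close> is only required to be a
  sub-\<open>\<sigma>\<close>-algebra containing all the others; the stopping-time condition at \<open>t = \<infinity>\<close> is vacuous, so
  its choice plays no role.
\<close>

definition usual_conditions :: "'a measure \<Rightarrow> (ennreal \<Rightarrow> 'a measure) \<Rightarrow> bool" where
  "usual_conditions M F \<longleftrightarrow>
     filtration (space M) F \<and> (\<forall>t. sets (F t) \<subseteq> sets M) \<and>
     complete_measure M \<and> null_sets M \<subseteq> sets (F 0) \<and>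
     (\<forall>t<\<infinity>. sets (F t) = (\<Inter>s\<in>{t<..}. sets (F s)))"

definition standard_brownian_motion ::
    "'a measure \<Rightarrow> (ennreal \<Rightarrow> 'a measure) \<Rightarrow> (real \<Rightarrow> 'a \<Rightarrow> real) \<Rightarrow> bool" where
  "standard_brownian_motion M F B \<longleftrightarrow>
     (\<forall>t\<ge>0. B t \<in> borel_measurable (F (ennreal t))) \<and>
     (AE \<omega> in M. B 0 \<omega> = 0) \<and>
     (AE \<omega> in M. continuous_on {0..} (\<lambda>t. B t \<omega>)) \<and>
     (\<forall>s t. 0 \<le> s \<longrightarrow> s < t \<longrightarrow>
        distributed M lborel (\<lambda>\<omega>. B t \<omega> - B s \<omega>)
          (\<lambda>x. ennreal (normal_density 0 (sqrt (t - s)) x)) \<and>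
        prob_space.indep_set M (sets (F (ennreal s)))
          {(\<lambda>\<omega>. B t \<omega> - B s \<omega>) -` S \<inter> space M | S. S \<in> sets borel})"

definition leisure_weight :: "real \<Rightarrow> real \<Rightarrow> real \<Rightarrow> real" where
  "leisure_weight \<gamma>s \<alpha> l = exp (- \<gamma>s * (1 - \<alpha>) * l)"

text \<open>
  For \<open>\<gamma> > 0\<close>, \<open>a > 0\<close> and \<open>y > 0\<close> the set below is nonempty and bounded above by \<open>0\<close>.
\<close>

definition dual_utility :: "real \<Rightarrow> real \<Rightarrow> real \<Rightarrow> real" where
  "dual_utility \<gamma> a y = (SUP c\<in>{0..}. - (exp (- \<gamma> * c) / \<gamma>) * a - c * y)"

definition dual_process ::
    "real \<Rightarrow> real \<Rightarrow> real \<Rightarrow> (real \<Rightarrow> 'a \<Rightarrow> real) \<Rightarrow> real \<Rightarrow> real \<Rightarrow> 'a \<Rightarrow> real" where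
  "dual_process \<beta> r \<theta> B y t \<omega> = y * exp ((\<beta> - r - \<theta>\<^sup>2 / 2) * t - \<theta> * B t \<omega>)"

text \<open>
  In the following three definitions \<open>X y\<close> is a real-valued process started at \<open>y\<close>, so the
  expectation written \<open>\<bbbE>\<^sup>y\<close> is the expectation under \<open>M\<close> of a functional of \<open>X y\<close>; \<open>h\<close> is the
  running payoff.
\<close>

definition expected_payoff ::
    "'a measure \<Rightarrow> real \<Rightarrow> (real \<Rightarrow> real) \<Rightarrow> (real \<Rightarrow> real \<Rightarrow> 'a \<Rightarrow> real) \<Rightarrow> real \<Rightarrow> ('a \<Rightarrow> ennreal) \<Rightarrow> real"
  where
  "expected_payoff M \<beta> h X y \<tau> =
     (\<integral>\<omega>. (LBINT s=0..enn2ereal (\<tau> \<omega>). exp (- \<beta> * s) * h (X y s \<omega>)) \<partial>M)"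

definition stopping_value ::
    "'a measure \<Rightarrow> (ennreal \<Rightarrow> 'a measure) \<Rightarrow> real \<Rightarrow> (real \<Rightarrow> real) \<Rightarrow> (real \<Rightarrow> real \<Rightarrow> 'a \<Rightarrow> real) \<Rightarrow> real \<Rightarrow> ereal"
  where
  "stopping_value M F \<beta> h X y =
     (SUP \<tau>\<in>{\<tau>. stopping_time F \<tau>}. ereal (expected_payoff M \<beta> h X y \<tau>))"

definition first_time_below :: "(real \<Rightarrow> 'a \<Rightarrow> real) \<Rightarrow> real \<Rightarrow> 'a \<Rightarrow> ennreal" where
  "first_time_below Z b \<omega> = Inf {ennreal s | s. 0 \<le> s \<and> Z s \<omega> \<le> b}"

definition optimal_boundary ::
    "'a measure \<Rightarrow> (ennreal \<Rightarrow> 'a measure) \<Rightarrow> real \<Rightarrow> (real \<Rightarrow> real) \<Rightarrow> (real \<Rightarrow> real \<Rightarrow> 'a \<Rightarrow> real) \<Rightarrow> real \<Rightarrow> bool"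
  where
  "optimal_boundary M F \<beta> h X b \<longleftrightarrow>
     0 \<le> b \<and>
     (\<forall>y>0. stopping_time F (first_time_below (X y) b) \<and>
            ereal (expected_payoff M \<beta> h X y (first_time_below (X y) b))
              = stopping_value M F \<beta> h X y)"

end

theory Submission
  imports Defs
begin

text \<open>
  Let \<open>h\<close> be the running payoff and \<open>\<kappa> = Y - (1 - \<alpha>) / \<alpha> * (L_over - L_under)\<close>. Then
  \<open>h y = \<kappa> y\<close> for \<open>0 < y \<le> A(L_over)\<close> and \<open>h y > \<kappa> y\<close> for larger \<open>y\<close>, so it suffices to compare
  a candidate boundary with the two constant stopping times \<open>0\<close> and \<open>\<infinity>\<close>. Write \<open>V(y)\<close> for
  the payoff of never stopping; it is finite because \<open>h\<close> grows linearly and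
  \<open>E [exp (- \<beta> s) y\<^sub>s] = y exp (- r s)\<close>.

  If \<open>\<kappa> < 0\<close>, dominated convergence gives \<open>V(y) / y \<longlonglongrightarrow> \<kappa> / r < 0\<close> as \<open>y\<close> tends to \<open>0\<close>, so stopping
  at once beats never stopping, and the boundary is not \<open>0\<close>. If \<open>\<kappa> \<ge> 0\<close>, then \<open>h \<ge> 0\<close>, and since
  the dual process exceeds \<open>A(L_over)\<close> with positive probability, \<open>V > 0\<close>; a boundary \<open>b > 0\<close>
  would stop at once from \<open>y = b\<close>, with payoff \<open>0\<close>.
\<close>

section \<open>Closed form of the dual utilities and of their difference\<close>

lemma dual_utility_eq:
  assumes "\<gamma> > 0" "a > 0" "y > 0"
  shows "dual_utility \<gamma> a y = (if y \<le> a then - (y / \<gamma>) * (1 + ln (a / y)) else - (a / \<gamma>))"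
proof -
  let ?f = "\<lambda>c. - (exp (- \<gamma> * c) / \<gamma>) * a - c * y"
  have eq: "dual_utility \<gamma> a y = ?f c0" if "c0 \<ge> 0" "\<And>c. c \<ge> 0 \<Longrightarrow> ?f c \<le> ?f c0" for c0
    unfolding dual_utility_def using that by (intro cSup_eq_maximum) auto
  show ?thesis
  proof (cases "y \<le> a")
    case True
    \<comment> \<open>The first-order condition \<open>a * exp (- \<gamma> * c) = y\<close> gives
      this maximiser; it is nonnegative exactly when \<open>y \<le> a\<close>.\<close>
    let ?c = "ln (a / y) / \<gamma>"
    have val: "?f ?c = - (y / \<gamma>) * (1 + ln (a / y))"
      using assms by (simp add: exp_minus field_simps)
    have "?f c \<le> - (y / \<gamma>) * (1 + ln (a / y))" for c
    proof -
      \<comment> \<open>The tangent inequality \<open>1 + x \<le> exp x\<close>, with equality at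
        \<open>c = ?c\<close>, replaces any differentiation.\<close>
      have "y * (1 + (ln (a / y) - \<gamma> * c)) \<le> y * exp (ln (a / y) - \<gamma> * c)"
        using assms by (intro mult_left_mono exp_ge_add_one_self) auto
      also have "\<dots> = a * exp (- \<gamma> * c)"
        using assms by (simp add: exp_diff exp_minus field_simps)
      finally have "\<gamma> * ?f c \<le> \<gamma> * (- (y / \<gamma>) * (1 + ln (a / y)))"
        using assms by (simp add: algebra_simps)
      then show ?thesis
        using assms by (simp only: mult_le_cancel_left_pos)
    qed
    then show ?thesis
      using eq[of ?c] val True assms by simp
  next
    case False
    \<comment> \<open>For \<open>y > a\<close> the unconstrained maximiser is negative, so the
      constraint binds at \<open>c = 0\<close>; the tangent inequality is applied around that
      point.\<close>
    have "?f c \<le> - (a / \<gamma>)" if "c \<ge> 0" for c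
    proof -
      have "\<gamma> * c * a \<le> \<gamma> * c * y"
        using False assms that by (intro mult_left_mono) auto
      then have "a - \<gamma> * c * y \<le> a * (1 + (- \<gamma> * c))"
        by (simp add: algebra_simps)
      also have "\<dots> \<le> a * exp (- \<gamma> * c)"
        using assms by (intro mult_left_mono exp_ge_add_one_self) auto
      finally have "\<gamma> * ?f c \<le> \<gamma> * - (a / \<gamma>)"
        using assms by (simp add: algebra_simps)
      then show ?thesis
        using assms by (simp only: mult_le_cancel_left_pos)
    qed
    then show ?thesis
      using eq[of 0] False by simp
  qed
qed

text \<open>The weight enters the objective with a negative sign; the closed form is compared on the
  three ranges of \<open>y\<close>. This yields the upper half of the linear bound on the running
  payoff.\<close>

lemma dual_utility_antimono:
  assumes "\<gamma> > 0" "0 < a" "a \<le> b" "y > 0"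
  shows "dual_utility \<gamma> b y \<le> dual_utility \<gamma> a y"
proof -
  consider "y \<le> a" | "a < y" "y \<le> b" | "b < y"
    by linarith
  then show ?thesis
  proof cases
    case 1
    have "ln (a / y) \<le> ln (b / y)"
      using assms by (simp add: divide_right_mono)
    then have "(y / \<gamma>) * (1 + ln (a / y)) \<le> (y / \<gamma>) * (1 + ln (b / y))"
      using assms by (intro mult_left_mono) auto
    then show ?thesis
      using 1 assms by (simp add: dual_utility_eq)
  next
    case 2
    have "0 \<le> ln (b / y)"
      using 2 assms by simp
    then have "(y / \<gamma>) * 1 \<le> (y / \<gamma>) * (1 + ln (b / y))"
      using assms by (intro mult_left_mono) auto
    moreover have "a / \<gamma> \<le> y / \<gamma>"
      using 2 assms by (intro divide_right_mono) auto
    ultimately show ?thesis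
      using 2 assms by (simp add: dual_utility_eq)
  next
    case 3
    then show ?thesis
      using assms by (simp add: dual_utility_eq divide_right_mono)
  qed
qed

text \<open>Both maximisers are interior here, so the \<open>y * ln y\<close> terms cancel and the
  difference is exactly linear.\<close>

lemma dual_utility_diff_small:
  assumes "\<gamma> > 0" "0 < a" "a \<le> b" "0 < y" "y \<le> a"
  shows "dual_utility \<gamma> b y - dual_utility \<gamma> a y = - (ln (b / a) / \<gamma>) * y"
  using assms by (simp add: dual_utility_eq ln_div field_simps)

text \<open>Once \<open>y > a\<close>, the constraint binds for the weight \<open>a\<close> and the
  linear formula becomes a strict lower bound. Strictness comes from \<open>ln x < x - 1\<close> for
  \<open>0 < x < 1\<close>, taken at \<open>x = a / y\<close> if \<open>y \<le> b\<close> and at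
  \<open>x = a / b\<close> otherwise.\<close>

lemma dual_utility_diff_large:
  assumes "\<gamma> > 0" "0 < a" "a < b" "a < y"
  shows "dual_utility \<gamma> b y - dual_utility \<gamma> a y > - (ln (b / a) / \<gamma>) * y"
proof -
  have lt: "ln x < x - 1" if "0 < x" "x < 1" for x :: real
    using ln_le_minus_one[of x] ln_eq_minus_one[of x] that by fastforce
  have "0 < y"
    using assms by simp
  show ?thesis
  proof (cases "y \<le> b")
    case True
    have "y * ln (a / y) < y * (a / y - 1)"
      using lt[of "a / y"] assms by (intro mult_strict_left_mono) auto
    then have "y * ln (a / y) < a - y"
      using \<open>0 < y\<close> by (simp add: right_diff_distrib)
    then have "\<gamma> * (- (ln (b / a) / \<gamma>) * y)
        < \<gamma> * (- (y / \<gamma>) * (1 + ln (b / y)) + a / \<gamma>)"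
      using assms \<open>0 < y\<close> by (simp add: ln_div algebra_simps diff_divide_distrib)
    then have "- (ln (b / a) / \<gamma>) * y < - (y / \<gamma>) * (1 + ln (b / y)) + a / \<gamma>"
      using assms by (simp only: mult_less_cancel_left_pos)
    then show ?thesis
      using True assms \<open>0 < y\<close> by (simp add: dual_utility_eq)
  next
    case False
    have "b * ln (a / b) < b * (a / b - 1)"
      using lt[of "a / b"] assms by (intro mult_strict_left_mono) auto
    then have "b - a < b * ln (b / a)"
      using assms by (simp add: ln_div right_diff_distrib)
    also have "\<dots> \<le> y * ln (b / a)"
      using False assms by (intro mult_right_mono) auto
    finally show ?thesis
      using False assms \<open>0 < y\<close> by (simp add: dual_utility_eq field_simps)
  qed
qed

section \<open>Measurability of processes and facts on the normal law\<close>

lemma AE_lborel_ex: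
  fixes a b :: real
  assumes "AE x in lborel. P x" "a < b"
  shows "\<exists>x\<in>{a<..<b}. P x"
proof (rule ccontr)
  assume neg: "\<not> ?thesis"
  have "AE x in lborel. x \<notin> {a<..<b}"
    using assms(1) by eventually_elim (use neg in blast)
  then have "{a<..<b} \<in> null_sets lborel"
    by (subst (asm) AE_iff_null_sets[symmetric]) auto
  then show False
    using \<open>a < b\<close> by (auto simp: null_sets_def)
qed

text \<open>Time is rounded down to the grid of mesh \<open>1 / Suc n\<close>. Each rounded process
  glues countably many measurable sections, and continuity of the paths gives pointwise
  convergence.\<close>

lemma borel_measurable_pair_continuous:
  fixes X :: "real \<Rightarrow> 'a \<Rightarrow> real"
  assumes meas: "\<And>t. X t \<in> borel_measurable M"
    and cont: "\<And>\<omega>. \<omega> \<in> space M \<Longrightarrow> continuous_on UNIV (\<lambda>t. X t \<omega>)"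
  shows "(\<lambda>(\<omega>, t). X t \<omega>) \<in> borel_measurable (M \<Otimes>\<^sub>M borel)"
proof (rule borel_measurable_LIMSEQ_real)
  let ?d = "\<lambda>n t. real_of_int \<lfloor>t * real (Suc n)\<rfloor> / real (Suc n)"
  let ?u = "\<lambda>n (\<omega>, t). X (?d n t) \<omega>"
  show "(\<lambda>n. ?u n z) \<longlonglongrightarrow> (case z of (\<omega>, t) \<Rightarrow> X t \<omega>)" if "z \<in> space (M \<Otimes>\<^sub>M borel)" for z
  proof -
    obtain \<omega> t where z: "z = (\<omega>, t)" "\<omega> \<in> space M"
      using \<open>z \<in> space _\<close> by (auto simp: space_pair_measure)
    have "(\<lambda>n. ?d n t) \<longlonglongrightarrow> t"
    proof (rule tendsto_sandwich)
      show "\<forall>\<^sub>F n in sequentially. t - 1 / real (Suc n) \<le> ?d n t"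
      proof (intro always_eventually allI)
        fix n
        have "t * real (Suc n) - 1 \<le> real_of_int \<lfloor>t * real (Suc n)\<rfloor>"
          by linarith
        then have "(t * real (Suc n) - 1) / real (Suc n) \<le> ?d n t"
          by (intro divide_right_mono) auto
        then show "t - 1 / real (Suc n) \<le> ?d n t"
          by (simp add: diff_divide_distrib del: of_nat_Suc)
      qed
      show "\<forall>\<^sub>F n in sequentially. ?d n t \<le> t"
        by (intro always_eventually allI) (simp add: pos_divide_le_eq del: of_nat_Suc)
      have "(\<lambda>n. t - 1 / real (Suc n)) \<longlonglongrightarrow> t - 0"
        by (intro tendsto_diff tendsto_const LIMSEQ_Suc[OF lim_1_over_n])
      then show "(\<lambda>n. t - 1 / real (Suc n)) \<longlonglongrightarrow> t"
        by simp
    qed simp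
    then show ?thesis
      using continuous_on_tendsto_compose[OF cont[OF z(2)], of "\<lambda>n. ?d n t" t] z(1) by simp
  qed
  show "?u n \<in> borel_measurable (M \<Otimes>\<^sub>M borel)" for n
  proof -
    have 1: "(\<lambda>z. X (real_of_int i / real (Suc n)) (fst z)) \<in> borel_measurable (M \<Otimes>\<^sub>M borel)" for i :: int
      by (rule measurable_compose[OF measurable_fst meas])
    have 2: "(\<lambda>z::'a \<times> real. \<lfloor>snd z * real (Suc n)\<rfloor>) \<in> (M \<Otimes>\<^sub>M borel) \<rightarrow>\<^sub>M count_space UNIV"
      by measurable
    show ?thesis
      using measurable_compose_countable[OF 1 2] by (simp add: case_prod_beta')
  qed
qed

text \<open>Completing the square turns the exponentially tilted density into
  \<open>exp (c\<^sup>2 * s / 2)\<close> times the normal density with mean \<open>c * s\<close>,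
  whose mass is 1.\<close>

lemma normal_mgf:
  assumes "distributed M lborel X (\<lambda>x. ennreal (normal_density 0 (sqrt s) x))" "s > 0"
  shows "(\<integral>\<^sup>+\<omega>. ennreal (exp (c * X \<omega>)) \<partial>M) = ennreal (exp (c\<^sup>2 * s / 2))"
proof -
  have shift: "normal_density 0 (sqrt s) x * exp (c * x)
      = exp (c\<^sup>2 * s / 2) * normal_density (c * s) (sqrt s) x" for x
  proof -
    have "- x\<^sup>2 / (2 * s) + c * x = c\<^sup>2 * s / 2 + - (x - c * s)\<^sup>2 / (2 * s)"
      using \<open>s > 0\<close> by (simp add: field_simps power2_eq_square)
    then show ?thesis
      using \<open>s > 0\<close> by (simp add: normal_density_def exp_add[symmetric])
  qed
  have "(\<integral>\<^sup>+\<omega>. ennreal (exp (c * X \<omega>)) \<partial>M)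
      = (\<integral>\<^sup>+x. ennreal (normal_density 0 (sqrt s) x) * ennreal (exp (c * x)) \<partial>lborel)"
    by (rule distributed_nn_integral[OF assms(1), symmetric]) simp
  also have "\<dots> = (\<integral>\<^sup>+x. ennreal (exp (c\<^sup>2 * s / 2)) * ennreal (normal_density (c * s) (sqrt s) x) \<partial>lborel)"
    by (simp add: ennreal_mult[symmetric] shift)
  also have "\<dots> = ennreal (exp (c\<^sup>2 * s / 2)) * (\<integral>\<^sup>+x. ennreal (normal_density (c * s) (sqrt s) x) \<partial>lborel)"
    by (rule nn_integral_cmult) simp
  also have "(\<integral>\<^sup>+x. ennreal (normal_density (c * s) (sqrt s) x) \<partial>lborel) = 1"
    using \<open>s > 0\<close> by (subst nn_integral_eq_integral) auto
  finally show ?thesis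
    by simp
qed

text \<open>The density is positive everywhere, so an almost sure lower bound would hold
  Lebesgue-almost everywhere, which fails on the interval from \<open>K - 1\<close> to
  \<open>K\<close>.\<close>

lemma normal_unbounded_below:
  assumes D: "distributed M lborel X (\<lambda>x. ennreal (normal_density 0 (sqrt s) x))" and "s > 0"
  shows "\<not> (AE \<omega> in M. K \<le> X \<omega>)"
proof
  assume "AE \<omega> in M. K \<le> X \<omega>"
  then have "AE x in distr M lborel X. K \<le> x"
    using distributed_measurable[OF D] by (subst AE_distr_iff) auto
  then have "AE x in lborel. 0 < ennreal (normal_density 0 (sqrt s) x) \<longrightarrow> K \<le> x"
    by (subst (asm) distributed_distr_eq_density[OF D], subst (asm) AE_density) auto
  then have "AE x in lborel. K \<le> x"
    using \<open>s > 0\<close> by (simp add: normal_density_pos)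
  from AE_lborel_ex[OF this, of "K - 1" K] show False
    by simp
qed

lemma (in complete_measure) borel_measurable_AE_eq:
  assumes g: "g \<in> measurable M N" and ae: "AE x in M. f x = g x" and f: "f \<in> space M \<rightarrow> space N"
  shows "f \<in> measurable M N"
proof (rule measurableI)
  fix A assume "A \<in> sets N"
  show "f -` A \<inter> space M \<in> sets M"
  proof (rule in_sets_AE)
    show "g -` A \<inter> space M \<in> sets M"
      using g \<open>A \<in> sets N\<close> by (rule measurable_sets)
    show "AE x in M. (x \<in> g -` A \<inter> space M) = (x \<in> f -` A \<inter> space M)"
      using ae by eventually_elim auto
  qed simp
qed (use f in auto)

section \<open>Integrals of the discounted dual process over paths and time\<close>

text \<open>By Fubini, the payoff of never stopping depends on the driving process only through its
  law at each single time; hence the assumptions are joint measurability and Gaussian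
  marginals.\<close>

locale discounted_dual = prob_space M for M :: "'a measure" +
  fixes W :: "real \<Rightarrow> 'a \<Rightarrow> real" and r \<beta> \<theta> :: real
  assumes W_measurable [measurable]: "(\<lambda>(\<omega>, s). W s \<omega>) \<in> borel_measurable (M \<Otimes>\<^sub>M lborel)"
    and W_normal: "s > 0 \<Longrightarrow> distributed M lborel (W s) (\<lambda>x. ennreal (normal_density 0 (sqrt s) x))"
    and r_pos: "r > 0"
begin

abbreviation Z :: "real \<Rightarrow> real \<Rightarrow> 'a \<Rightarrow> real" where
  "Z \<equiv> dual_process \<beta> r \<theta> W"

text \<open>Its integral over the product space is the payoff of never stopping. The indicator
  restricts the Lebesgue measure of the whole line to positive times.\<close>

definition payoff_density :: "(real \<Rightarrow> real) \<Rightarrow> real \<Rightarrow> 'a \<times> real \<Rightarrow> real" where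
  "payoff_density g y = (\<lambda>(\<omega>, s). indicator {0<..} s * (exp (- \<beta> * s) * g (Z y s \<omega>)))"

sublocale P: pair_sigma_finite M lborel
  by (simp add: pair_sigma_finite_def sigma_finite_measure_axioms lborel.sigma_finite_measure_axioms)

lemma Z_pos: "y > 0 \<Longrightarrow> Z y s \<omega> > 0"
  by (simp add: dual_process_def)

lemma payoff_density_measurable [measurable]:
  assumes [measurable]: "g \<in> borel_measurable borel"
  shows "payoff_density g y \<in> borel_measurable (M \<Otimes>\<^sub>M lborel)"
  unfolding payoff_density_def dual_process_def by measurable

text \<open>The moment generating function at \<open>- \<theta>\<close> cancels the drift
  \<open>- \<theta>\<^sup>2 / 2\<close>, leaving \<open>exp (- r * s)\<close>, which is
  \<open>1 / r\<close> times the exponential density of rate \<open>r\<close>. This function is the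
  majorant in the domination arguments below.\<close>

lemma payoff_density_id:
  "has_bochner_integral (M \<Otimes>\<^sub>M lborel) (payoff_density (\<lambda>x. x) 1) (1 / r)"
proof (rule has_bochner_integral_nn_integral)
  let ?G = "payoff_density (\<lambda>x. x) 1"
  show meas: "?G \<in> borel_measurable (M \<Otimes>\<^sub>M lborel)"
    by measurable
  show "AE z in M \<Otimes>\<^sub>M lborel. 0 \<le> ?G z"
    by (intro AE_I2) (auto simp: payoff_density_def dual_process_def)
  show "0 \<le> 1 / r"
    using r_pos by simp
  \<comment> \<open>Time \<open>0\<close> is excluded: there the exponential density equals
    \<open>r\<close>, whereas the indicator vanishes.\<close>
  have inner: "(\<integral>\<^sup>+\<omega>. ennreal (?G (\<omega>, s)) \<partial>M) = ennreal (1 / r) * ennreal (exponential_density r s)"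
    if "s \<noteq> 0" for s
  proof (cases "s > 0")
    case True
    have *: "ennreal (?G (\<omega>, s))
        = ennreal (exp ((- r - \<theta>\<^sup>2 / 2) * s)) * ennreal (exp (- \<theta> * W s \<omega>))" for \<omega>
      using True by (simp add: payoff_density_def dual_process_def ennreal_mult[symmetric]
          exp_add[symmetric] algebra_simps)
    have [measurable]: "W s \<in> borel_measurable M"
      using distributed_measurable[OF W_normal[OF True]] by simp
    have "(\<integral>\<^sup>+\<omega>. ennreal (?G (\<omega>, s)) \<partial>M)
        = ennreal (exp ((- r - \<theta>\<^sup>2 / 2) * s)) * ennreal (exp ((- \<theta>)\<^sup>2 * s / 2))"
      unfolding * using normal_mgf[OF W_normal[OF True] True, of "- \<theta>"]
      by (subst nn_integral_cmult) auto
    also have "\<dots> = ennreal (exp (- r * s))"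
      by (simp add: ennreal_mult[symmetric] exp_add[symmetric] algebra_simps)
    also have "\<dots> = ennreal (1 / r) * ennreal (exponential_density r s)"
      using True r_pos by (simp add: ennreal_mult[symmetric] exponential_density_def mult.commute)
    finally show ?thesis .
  next
    case False
    then show ?thesis
      using that by (simp add: payoff_density_def exponential_density_def)
  qed
  have "(\<integral>\<^sup>+z. ennreal (?G z) \<partial>(M \<Otimes>\<^sub>M lborel)) = (\<integral>\<^sup>+s. (\<integral>\<^sup>+\<omega>. ennreal (?G (\<omega>, s)) \<partial>M) \<partial>lborel)"
    using P.nn_integral_snd[of "\<lambda>z. ennreal (?G z)"] by simp
  also have "\<dots> = (\<integral>\<^sup>+s. ennreal (1 / r) * ennreal (exponential_density r s) \<partial>lborel)"
    by (intro nn_integral_cong_AE)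
      (use AE_lborel_singleton[of "0::real"] in \<open>eventually_elim, use inner in auto\<close>)
  also have "\<dots> = ennreal (1 / r) * (\<integral>\<^sup>+s. ennreal (exponential_density r s) \<partial>lborel)"
    by (rule nn_integral_cmult) simp
  also have "(\<integral>\<^sup>+s. ennreal (exponential_density r s) \<partial>lborel) = 1"
    using prob_space.emeasure_space_1[OF prob_space_exponential_density[OF r_pos]]
    by (simp add: emeasure_density)
  finally show "(\<integral>\<^sup>+z. ennreal (?G z) \<partial>(M \<Otimes>\<^sub>M lborel)) = ennreal (1 / r)"
    by simp
qed

text \<open>The process is linear in its start, so multiples of the density with start
  \<open>1\<close> dominate for all starts.\<close>

lemma payoff_density_bound:
  assumes "\<And>x. x > 0 \<Longrightarrow> \<bar>g x\<bar> \<le> C * x" "y > 0"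
  shows "\<bar>payoff_density g y z\<bar> \<le> C * y * payoff_density (\<lambda>x. x) 1 z"
proof -
  obtain \<omega> s where z: "z = (\<omega>, s)"
    by (cases z)
  have "Z y s \<omega> = y * Z 1 s \<omega>"
    by (simp add: dual_process_def)
  then have "\<bar>g (Z y s \<omega>)\<bar> \<le> C * (y * Z 1 s \<omega>)"
    using assms(1)[OF Z_pos[OF assms(2)], of s \<omega>] by simp
  then have "exp (- \<beta> * s) * \<bar>g (Z y s \<omega>)\<bar> \<le> exp (- \<beta> * s) * (C * (y * Z 1 s \<omega>))"
    by (intro mult_left_mono) auto
  then show ?thesis
    by (simp add: z payoff_density_def abs_mult mult_ac split: split_indicator)
qed

lemma payoff_density_integrable:
  assumes [measurable]: "g \<in> borel_measurable borel"
    and "\<And>x. x > 0 \<Longrightarrow> \<bar>g x\<bar> \<le> C * x" "y > 0"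
  shows "integrable (M \<Otimes>\<^sub>M lborel) (payoff_density g y)"
proof (rule Bochner_Integration.integrable_bound)
  show "integrable (M \<Otimes>\<^sub>M lborel) (\<lambda>z. C * y * payoff_density (\<lambda>x. x) 1 z)"
    using payoff_density_id by (auto simp: has_bochner_integral_iff)
  show "AE z in M \<Otimes>\<^sub>M lborel. norm (payoff_density g y z) \<le> norm (C * y * payoff_density (\<lambda>x. x) 1 z)"
  proof (intro AE_I2)
    fix z
    show "norm (payoff_density g y z) \<le> norm (C * y * payoff_density (\<lambda>x. x) 1 z)"
      using payoff_density_bound[of g C y z] assms(2,3) by simp
  qed
qed measurable

text \<open>If the integral vanished, the process would stay below \<open>a\<close> almost surely at
  some positive time, forcing an almost sure lower bound on a Gaussian variable.\<close>

lemma payoff_density_integral_pos: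
  assumes [measurable]: "g \<in> borel_measurable borel"
    and bound: "\<And>x. x > 0 \<Longrightarrow> \<bar>g x\<bar> \<le> C * x"
    and nonneg: "\<And>x. x > 0 \<Longrightarrow> g x \<ge> 0" and pos: "\<And>x. x > a \<Longrightarrow> g x > 0"
    and "a > 0" "\<theta> > 0" "y > 0"
  shows "integral\<^sup>L (M \<Otimes>\<^sub>M lborel) (payoff_density g y) > 0"
proof (rule ccontr)
  assume neg: "\<not> ?thesis"
  have ge: "payoff_density g y z \<ge> 0" for z
    using nonneg Z_pos[OF \<open>y > 0\<close>] by (cases z) (auto simp: payoff_density_def)
  have "integral\<^sup>L (M \<Otimes>\<^sub>M lborel) (payoff_density g y) \<ge> 0"
    using ge by (intro integral_nonneg_AE) auto
  with neg have "integral\<^sup>L (M \<Otimes>\<^sub>M lborel) (payoff_density g y) = 0"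
    by linarith
  then have "AE z in M \<Otimes>\<^sub>M lborel. payoff_density g y z = 0"
    using payoff_density_integrable[OF assms(1) bound \<open>y > 0\<close>] ge
    by (subst (asm) integral_nonneg_eq_0_iff_AE) auto
  then have "AE \<omega> in M. AE s in lborel. payoff_density g y (\<omega>, s) = 0"
    by (rule P.AE_pair)
  \<comment> \<open>The quantifiers are exchanged so that one time \<open>s\<close> can be fixed
    before the path.\<close>
  then have "AE s in lborel. AE \<omega> in M. payoff_density g y (\<omega>, s) = 0"
    by (subst (asm) P.AE_commute) measurable
  from AE_lborel_ex[OF this, of 0 1]
  obtain s where "s > 0" and s: "AE \<omega> in M. payoff_density g y (\<omega>, s) = 0"
    by auto
  \<comment> \<open>The constant solves \<open>Z y s \<omega> \<le> a\<close> for
    \<open>W s \<omega>\<close>; dividing by \<open>\<theta> > 0\<close> keeps the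
    direction.\<close>
  have "AE \<omega> in M. ((\<beta> - r - \<theta>\<^sup>2 / 2) * s - ln (a / y)) / \<theta> \<le> W s \<omega>"
    using s
  proof eventually_elim
    case (elim \<omega>)
    then have "g (Z y s \<omega>) = 0"
      using \<open>s > 0\<close> by (simp add: payoff_density_def)
    then have "Z y s \<omega> \<le> a"
      using pos[of "Z y s \<omega>"] by fastforce
    then have "exp ((\<beta> - r - \<theta>\<^sup>2 / 2) * s - \<theta> * W s \<omega>) \<le> a / y"
      using \<open>y > 0\<close> by (simp add: dual_process_def field_simps)
    then have "(\<beta> - r - \<theta>\<^sup>2 / 2) * s - \<theta> * W s \<omega> \<le> ln (a / y)"
      using \<open>a > 0\<close> \<open>y > 0\<close> by (subst ln_ge_iff) auto
    then show ?case
      using \<open>\<theta> > 0\<close> by (simp add: field_simps)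
  qed
  with normal_unbounded_below[OF W_normal[OF \<open>s > 0\<close>] \<open>s > 0\<close>] show False
    by blast
qed

text \<open>Along starts \<open>e n\<close> tending to \<open>0\<close>, the density divided by
  \<open>e n\<close> is dominated by \<open>C * G\<close>. At each fixed point the process
  eventually lies below \<open>a\<close>, where \<open>g\<close> is linear, so the quotient
  eventually equals \<open>\<kappa> * G\<close>.\<close>

lemma payoff_density_integral_neg:
  assumes g: "g \<in> borel_measurable borel"
    and bound: "\<And>x. x > 0 \<Longrightarrow> \<bar>g x\<bar> \<le> C * x"
    and lin: "\<And>x. 0 < x \<Longrightarrow> x \<le> a \<Longrightarrow> g x = \<kappa> * x"
    and "a > 0" "\<kappa> < 0"
  obtains y where "y > 0" "integral\<^sup>L (M \<Otimes>\<^sub>M lborel) (payoff_density g y) < 0"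
proof -
  define G where "G = payoff_density (\<lambda>x. x) 1"
  define e where "e n = 1 / real (Suc n)" for n
  have e_pos: "e n > 0" for n
    by (simp add: e_def)
  have e_lim: "e \<longlonglongrightarrow> 0"
    unfolding e_def by (rule LIMSEQ_Suc[OF lim_1_over_n])
  have G_int: "integrable (M \<Otimes>\<^sub>M lborel) G" and G_val: "integral\<^sup>L (M \<Otimes>\<^sub>M lborel) G = 1 / r"
    using payoff_density_id by (simp_all add: has_bochner_integral_iff G_def)
  have G_meas: "G \<in> borel_measurable (M \<Otimes>\<^sub>M lborel)"
    using G_int by (rule borel_measurable_integrable)
  note pd_meas = payoff_density_measurable[OF g]
  have "(\<lambda>n. integral\<^sup>L (M \<Otimes>\<^sub>M lborel) (\<lambda>z. payoff_density g (e n) z / e n))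
      \<longlonglongrightarrow> integral\<^sup>L (M \<Otimes>\<^sub>M lborel) (\<lambda>z. \<kappa> * G z)"
  proof (rule integral_dominated_convergence[where w = "\<lambda>z. C * G z"])
    show "(\<lambda>z. \<kappa> * G z) \<in> borel_measurable (M \<Otimes>\<^sub>M lborel)"
      using G_meas by simp
    show "(\<lambda>z. payoff_density g (e n) z / e n) \<in> borel_measurable (M \<Otimes>\<^sub>M lborel)" for n
      using pd_meas[of "e n"] by simp
    show "integrable (M \<Otimes>\<^sub>M lborel) (\<lambda>z. C * G z)"
      using G_int by simp
    show "AE z in M \<Otimes>\<^sub>M lborel. norm (payoff_density g (e n) z / e n) \<le> C * G z" for n
    proof (intro AE_I2)
      fix z
      have "\<bar>payoff_density g (e n) z\<bar> \<le> C * e n * G z"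
        unfolding G_def by (rule payoff_density_bound[OF bound e_pos])
      then show "norm (payoff_density g (e n) z / e n) \<le> C * G z"
        using e_pos[of n] by (simp add: pos_divide_le_eq mult_ac)
    qed
    show "AE z in M \<Otimes>\<^sub>M lborel. (\<lambda>n. payoff_density g (e n) z / e n) \<longlonglongrightarrow> \<kappa> * G z"
    proof (intro AE_I2)
      fix z :: "'a \<times> real"
      obtain \<omega> s where z: "z = (\<omega>, s)"
        by (cases z)
      have "(\<lambda>n. e n * Z 1 s \<omega>) \<longlonglongrightarrow> 0 * Z 1 s \<omega>"
        by (intro tendsto_mult tendsto_const e_lim)
      then have "\<forall>\<^sub>F n in sequentially. e n * Z 1 s \<omega> < a"
        using \<open>a > 0\<close> by (intro order_tendstoD) auto
      then have "\<forall>\<^sub>F n in sequentially. payoff_density g (e n) z / e n = \<kappa> * G z"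
      proof eventually_elim
        case (elim n)
        have Z: "Z (e n) s \<omega> = e n * Z 1 s \<omega>"
          by (simp add: dual_process_def)
        have gZ: "g (Z (e n) s \<omega>) = \<kappa> * (e n * Z 1 s \<omega>)"
          unfolding Z using elim Z_pos[of 1 s \<omega>] e_pos[of n] by (intro lin mult_pos_pos) auto
        have "payoff_density g (e n) z = \<kappa> * G z * e n"
          unfolding G_def payoff_density_def z prod.case gZ by (simp only: mult_ac)
        then show ?case
          using e_pos[of n] by simp
      qed
      then show "(\<lambda>n. payoff_density g (e n) z / e n) \<longlonglongrightarrow> \<kappa> * G z"
        by (rule tendsto_eventually)
    qed
  qed
  then have "(\<lambda>n. integral\<^sup>L (M \<Otimes>\<^sub>M lborel) (payoff_density g (e n)) / e n) \<longlonglongrightarrow> \<kappa> / r"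
    by (simp add: G_val)
  moreover have "\<kappa> / r < 0"
    using \<open>\<kappa> < 0\<close> r_pos by (rule divide_neg_pos)
  ultimately have "\<forall>\<^sub>F n in sequentially. integral\<^sup>L (M \<Otimes>\<^sub>M lborel) (payoff_density g (e n)) / e n < 0"
    by (rule order_tendstoD)
  then obtain n where "integral\<^sup>L (M \<Otimes>\<^sub>M lborel) (payoff_density g (e n)) / e n < 0"
    by (rule eventually_happens'[OF sequentially_bot, THEN exE])
  then have "integral\<^sup>L (M \<Otimes>\<^sub>M lborel) (payoff_density g (e n)) < 0"
    using e_pos[of n] by (simp add: divide_less_0_iff)
  then show thesis
    by (rule that[OF e_pos])
qed

text \<open>This connects the iterated integral for \<open>B\<close> and \<open>h\<close> with the
  product integral for \<open>W\<close> and \<open>g\<close>. The function \<open>g\<close> is a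
  Borel substitute for \<open>h\<close>, which is defined through suprema, and \<open>W\<close> a
  jointly measurable substitute for \<open>B\<close>.\<close>

lemma expected_payoff_never:
  assumes "complete_measure M"
    and [measurable]: "g \<in> borel_measurable borel" and bound: "\<And>x. x > 0 \<Longrightarrow> \<bar>g x\<bar> \<le> C * x"
    and "y > 0" and h: "\<And>x. x > 0 \<Longrightarrow> h x = g x"
    and B: "AE \<omega> in M. \<forall>s\<ge>0. B s \<omega> = W s \<omega>"
  shows "expected_payoff M \<beta> h (dual_process \<beta> r \<theta> B) y (\<lambda>_. \<infinity>)
      = integral\<^sup>L (M \<Otimes>\<^sub>M lborel) (payoff_density g y)"
proof -
  let ?L = "\<lambda>\<omega>. LBINT s=0..enn2ereal \<infinity>. exp (- \<beta> * s) * h (dual_process \<beta> r \<theta> B y s \<omega>)"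
  let ?R = "\<lambda>\<omega>. \<integral>s. payoff_density g y (\<omega>, s) \<partial>lborel"
  note int = payoff_density_integrable[OF assms(2) bound \<open>y > 0\<close>]
  have eq: "AE \<omega> in M. ?L \<omega> = ?R \<omega>"
    using B
  proof eventually_elim
    case (elim \<omega>)
    have "?L \<omega> = (LBINT s:{0<..}. exp (- \<beta> * s) * h (dual_process \<beta> r \<theta> B y s \<omega>))"
      using interval_integral_to_infinity_eq[of lborel 0] by (simp add: zero_ereal_def)
    also have "\<dots> = ?R \<omega>"
      unfolding set_lebesgue_integral_def
    proof (rule Bochner_Integration.integral_cong[OF refl])
      fix s
      show "indicat_real {0<..} s *\<^sub>R (exp (- \<beta> * s) * h (dual_process \<beta> r \<theta> B y s \<omega>))
          = payoff_density g y (\<omega>, s)"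
        using elim h[OF Z_pos[OF \<open>y > 0\<close>]]
        by (auto simp: payoff_density_def dual_process_def split: split_indicator)
    qed
    finally show ?case .
  qed
  have R: "?R \<in> borel_measurable M"
    using P.integrable_fst'[OF int] by (rule borel_measurable_integrable)
  \<comment> \<open>Completeness supplies the measurability. It matters because the Bochner integral
    of a nonmeasurable function is \<open>0\<close> by default.\<close>
  have "?L \<in> borel_measurable M"
    by (rule complete_measure.borel_measurable_AE_eq[OF \<open>complete_measure M\<close> R eq]) simp
  then have "expected_payoff M \<beta> h (dual_process \<beta> r \<theta> B) y (\<lambda>_. \<infinity>) = (\<integral>\<omega>. ?R \<omega> \<partial>M)"
    unfolding expected_payoff_def by (intro integral_cong_AE R eq)
  also have "\<dots> = integral\<^sup>L (M \<Otimes>\<^sub>M lborel) (payoff_density g y)"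
    by (rule P.integral_fst'[OF int])
  finally show ?thesis .
qed

end

section \<open>A jointly measurable version of the Brownian motion\<close>

lemma brownian_version:
  fixes M :: "'a measure"
  assumes "prob_space M" and U: "usual_conditions M F" and BM: "standard_brownian_motion M F B"
    and "r > 0"
  obtains W where "discounted_dual M W r" "AE \<omega> in M. \<forall>s\<ge>0. B s \<omega> = W s \<omega>"
proof -
  interpret prob_space M by fact
  have B_meas: "B t \<in> borel_measurable M" if "t \<ge> 0" for t
  proof -
    have "filtration (space M) F" "sets (F (ennreal t)) \<subseteq> sets M"
      using U by (simp_all only: usual_conditions_def)
    then have "space (F (ennreal t)) = space M" "sets (F (ennreal t)) \<subseteq> sets M"
      by (auto simp: filtration_def)
    moreover have "B t \<in> borel_measurable (F (ennreal t))"
      using BM that by (auto simp: standard_brownian_motion_def)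
    ultimately show ?thesis
      by (auto simp: measurable_def)
  qed
  have "AE \<omega> in M. continuous_on {0..} (\<lambda>t. B t \<omega>)"
    using BM by (auto simp: standard_brownian_motion_def)
  then obtain N where N: "{\<omega>\<in>space M. \<not> continuous_on {0..} (\<lambda>t. B t \<omega>)} \<subseteq> N" "N \<in> null_sets M"
    by (auto simp: eventually_ae_filter)
  \<comment> \<open>Resetting the paths in the null set \<open>N\<close> to \<open>0\<close> and
    freezing the others before time \<open>0\<close> makes every path continuous on the whole
    line.\<close>
  define W where "W = (\<lambda>t \<omega>. if \<omega> \<in> N then 0 else B (max 0 t) \<omega>)"
  have [measurable]: "N \<in> sets M"
    using N by auto
  have W_meas: "W t \<in> borel_measurable M" for t
  proof -
    have [measurable]: "B (max 0 t) \<in> borel_measurable M"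
      by (rule B_meas) simp
    show ?thesis
      unfolding W_def by measurable
  qed
  have W_cont: "continuous_on UNIV (\<lambda>t. W t \<omega>)" if "\<omega> \<in> space M" for \<omega>
  proof (cases "\<omega> \<in> N")
    case False
    then have "continuous_on {0..} (\<lambda>t. B t \<omega>)"
      using N that by auto
    then have "continuous_on UNIV (\<lambda>t. B (max 0 t) \<omega>)"
      by (rule continuous_on_compose2) (auto intro!: continuous_intros)
    then show ?thesis
      using False by (simp add: W_def)
  qed (simp add: W_def)
  have notN: "AE \<omega> in M. \<omega> \<notin> N"
    using N by (intro AE_not_in)
  have BW: "AE \<omega> in M. \<forall>s\<ge>0. B s \<omega> = W s \<omega>"
    using notN by eventually_elim (auto simp: W_def max_def)
  have B0: "AE \<omega> in M. B 0 \<omega> = 0"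
    using BM by (auto simp: standard_brownian_motion_def)
  have "discounted_dual M W r"
  proof
    show "(\<lambda>(\<omega>, s). W s \<omega>) \<in> borel_measurable (M \<Otimes>\<^sub>M lborel)"
      using borel_measurable_pair_continuous[OF W_meas W_cont]
      by (simp cong: measurable_cong_sets sets_pair_measure_cong)
    fix s :: real assume "s > 0"
    \<comment> \<open>The law is known for increments only; as \<open>B 0\<close> vanishes almost
      surely, the increment from time \<open>0\<close> has the law of \<open>W s\<close>.\<close>
    then have D: "distributed M lborel (\<lambda>\<omega>. B s \<omega> - B 0 \<omega>) (\<lambda>x. ennreal (normal_density 0 (sqrt s) x))"
      using BM by (force simp: standard_brownian_motion_def)
    have "AE \<omega> in M. B s \<omega> - B 0 \<omega> = W s \<omega>"
      using BW B0 by eventually_elim (use \<open>s > 0\<close> in auto)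
    then have "distr M lborel (\<lambda>\<omega>. B s \<omega> - B 0 \<omega>) = distr M lborel (W s)"
      using distributed_measurable[OF D] W_meas[of s] by (intro distr_cong_AE) auto
    then show "distributed M lborel (W s) (\<lambda>x. ennreal (normal_density 0 (sqrt s) x))"
      using D W_meas[of s] by (simp add: distributed_def)
  qed fact
  then show thesis
    using BW by (rule that)
qed

section \<open>Comparison of the boundary with stopping at once and with never stopping\<close>

theorem corollary6p3:
  fixes M :: "'a measure"
    and F :: "ennreal \<Rightarrow> 'a measure"
    and B :: "real \<Rightarrow> 'a \<Rightarrow> real"
    and r \<mu> \<sigma> \<theta> \<beta> \<alpha> \<gamma>s \<gamma> Y L_under L_over y_bar :: real
    and U_over U_under :: "real \<Rightarrow> real"
  assumes "prob_space M"
    and "usual_conditions M F"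
    and "standard_brownian_motion M F B"
    and "r > 0" and "\<mu> > r" and "\<sigma> > 0" and "\<theta> = (\<mu> - r) / \<sigma>"
    and "\<beta> > 0" and "0 < \<alpha>" and "\<alpha> < 1" and "\<gamma>s > 0" and "\<gamma> = \<alpha> * \<gamma>s"
    and "Y > 0" and "0 < L_under" and "L_under < L_over"
    and "U_over = dual_utility \<gamma> (leisure_weight \<gamma>s \<alpha> L_over)"
    and "U_under = dual_utility \<gamma> (leisure_weight \<gamma>s \<alpha> L_under)"
    and "optimal_boundary M F \<beta> (\<lambda>y. U_under y - U_over y + Y * y)
           (dual_process \<beta> r \<theta> B) y_bar"
  shows "y_bar = 0 \<longleftrightarrow> Y \<ge> (1 - \<alpha>) / \<alpha> * (L_over - L_under)"
proof -
  define a where "a = leisure_weight \<gamma>s \<alpha> L_over"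
  define b where "b = leisure_weight \<gamma>s \<alpha> L_under"
  define \<kappa> where "\<kappa> = Y - (1 - \<alpha>) / \<alpha> * (L_over - L_under)"
  define h where "h = (\<lambda>y. U_under y - U_over y + Y * y)"
  define u where "u = (\<lambda>a y. if y \<le> a then - (y / \<gamma>) * (1 + ln (a / y)) else - (a / \<gamma>))"
  define g where "g = (\<lambda>y. u b y - u a y + Y * y)"
  let ?X = "dual_process \<beta> r \<theta> B"
  let ?V = "\<lambda>y. expected_payoff M \<beta> h ?X y (\<lambda>_. \<infinity>)"
  have "\<gamma> > 0"
    using assms by simp
  have "\<theta> > 0"
    using assms by simp
  have "a > 0" "a < b"
    using assms by (auto simp: a_def b_def leisure_weight_def)
  \<comment> \<open>The threshold originates here: the log-ratio of the leisure weights, divided by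
    \<open>\<gamma> = \<alpha> * \<gamma>s\<close>, is the slope lost by the utility
    difference.\<close>
  have "ln (b / a) = \<gamma>s * (1 - \<alpha>) * (L_over - L_under)"
    by (simp add: a_def b_def leisure_weight_def ln_div algebra_simps)
  then have slope: "ln (b / a) / \<gamma> = (1 - \<alpha>) / \<alpha> * (L_over - L_under)"
    using assms by (simp add: field_simps)
  have h_eq: "h y = dual_utility \<gamma> b y - dual_utility \<gamma> a y + Y * y" for y
    by (simp add: h_def a_def b_def assms)
  have hg: "h y = g y" if "y > 0" for y
    using that \<open>\<gamma> > 0\<close> \<open>a > 0\<close> \<open>a < b\<close> by (simp add: h_eq g_def u_def dual_utility_eq)
  have g_small: "g y = \<kappa> * y" if "0 < y" "y \<le> a" for y
    using dual_utility_diff_small[of \<gamma> a b y] that \<open>\<gamma> > 0\<close> \<open>a > 0\<close> \<open>a < b\<close>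
    by (simp add: hg[symmetric] h_eq slope \<kappa>_def algebra_simps)
  have g_large: "g y > \<kappa> * y" if "a < y" for y
  proof -
    have "y > 0"
      using that \<open>a > 0\<close> by simp
    then show ?thesis
      using dual_utility_diff_large[of \<gamma> a b y] that \<open>\<gamma> > 0\<close> \<open>a > 0\<close> \<open>a < b\<close>
      by (simp add: hg[symmetric] h_eq slope \<kappa>_def algebra_simps)
  qed
  have g_ge: "g y \<ge> \<kappa> * y" if "y > 0" for y
    using g_small[of y] g_large[of y] that by fastforce
  have g_le: "g y \<le> Y * y" if "y > 0" for y
    using dual_utility_antimono[of \<gamma> a b y] that \<open>\<gamma> > 0\<close> \<open>a > 0\<close> \<open>a < b\<close>
    by (simp add: hg[symmetric] h_eq)
  have bound: "\<bar>g y\<bar> \<le> (\<bar>\<kappa>\<bar> + Y) * y" if "y > 0" for y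
  proof -
    have "- \<bar>\<kappa>\<bar> * y \<le> \<kappa> * y"
      using that by (intro mult_right_mono) auto
    moreover have "0 \<le> \<bar>\<kappa>\<bar> * y" "0 \<le> Y * y"
      using that \<open>Y > 0\<close> by auto
    ultimately show ?thesis
      using g_ge[OF that] g_le[OF that] by (simp add: abs_le_iff algebra_simps)
  qed
  have g_meas: "g \<in> borel_measurable borel"
    unfolding g_def u_def by measurable
  obtain W where "discounted_dual M W r" and BW: "AE \<omega> in M. \<forall>s\<ge>0. B s \<omega> = W s \<omega>"
    using brownian_version[OF assms(1-4)] .
  then interpret discounted_dual M W r \<beta> \<theta>
    by simp
  have compl: "complete_measure M"
    using assms(2) by (simp add: usual_conditions_def)
  have V: "?V y = integral\<^sup>L (M \<Otimes>\<^sub>M lborel) (payoff_density g y)" if "y > 0" for y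
    using expected_payoff_never[OF compl g_meas bound that hg BW] by simp
  have opt: "ereal (expected_payoff M \<beta> h ?X y (first_time_below (?X y) y_bar))
      = stopping_value M F \<beta> h ?X y" if "y > 0" for y
    using assms(18) that by (simp add: optimal_boundary_def h_def)
  \<comment> \<open>Constants are stopping times; this is applied with \<open>c = 0\<close> and
    \<open>c = \<infinity>\<close>.\<close>
  have best: "expected_payoff M \<beta> h ?X y (\<lambda>_. c)
      \<le> expected_payoff M \<beta> h ?X y (first_time_below (?X y) y_bar)" if "y > 0" for y c
  proof -
    have "ereal (expected_payoff M \<beta> h ?X y (\<lambda>_. c)) \<le> stopping_value M F \<beta> h ?X y"
      unfolding stopping_value_def by (intro SUP_upper) (simp add: stopping_time_const)
    then show ?thesis
      by (simp flip: opt[OF that])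
  qed
  show ?thesis
  proof
    assume "y_bar = 0"
    \<comment> \<open>A positive process never reaches \<open>0\<close>, so the infimum is over the
      empty set.\<close>
    have never: "first_time_below (?X y) y_bar = (\<lambda>_. \<infinity>)" if "y > 0" for y
      using that by (auto simp: first_time_below_def \<open>y_bar = 0\<close> dual_process_def mult_le_0_iff not_le)
    \<comment> \<open>Stopping at time \<open>0\<close> pays an integral over an empty
      interval.\<close>
    have V_nonneg: "?V y \<ge> 0" if "y > 0" for y
      using best[OF that, of 0] that by (simp add: never expected_payoff_def zero_ennreal.rep_eq)
    show "Y \<ge> (1 - \<alpha>) / \<alpha> * (L_over - L_under)"
    proof (rule ccontr)
      assume "\<not> ?thesis"
      then have "\<kappa> < 0"
        by (simp add: \<kappa>_def)
      from payoff_density_integral_neg[OF g_meas bound g_small \<open>a > 0\<close> this]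
      obtain y where "y > 0" "integral\<^sup>L (M \<Otimes>\<^sub>M lborel) (payoff_density g y) < 0"
        by blast
      then show False
        using V_nonneg[of y] V[of y] by simp
    qed
  next
    assume "Y \<ge> (1 - \<alpha>) / \<alpha> * (L_over - L_under)"
    then have "\<kappa> \<ge> 0"
      by (simp add: \<kappa>_def)
    show "y_bar = 0"
    proof (rule ccontr)
      assume "y_bar \<noteq> 0"
      then have "y_bar > 0"
        using assms(18) by (simp add: optimal_boundary_def)
      have "AE \<omega> in M. B 0 \<omega> = 0"
        using assms(3) by (simp add: standard_brownian_motion_def)
      \<comment> \<open>The start \<open>y_bar\<close> lies on the boundary itself. Stopping at once
        is only almost sure, because \<open>B 0 = 0\<close> is.\<close>
      then have "AE \<omega> in M. first_time_below (?X y_bar) y_bar \<omega> = 0"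
      proof eventually_elim
        case (elim \<omega>)
        have "first_time_below (?X y_bar) y_bar \<omega> \<le> ennreal 0"
          unfolding first_time_below_def using elim
          by (intro Inf_lower CollectI exI[of _ "0::real"]) (auto simp: dual_process_def)
        then show ?case
          by simp
      qed
      then have "expected_payoff M \<beta> h ?X y_bar (first_time_below (?X y_bar) y_bar) = 0"
        unfolding expected_payoff_def by (intro integral_eq_zero_AE) (auto simp: zero_ennreal.rep_eq elim!: eventually_mono)
      then have "?V y_bar \<le> 0"
        using best[OF \<open>y_bar > 0\<close>, of \<infinity>] by simp
      moreover have "?V y_bar > 0"
        unfolding V[OF \<open>y_bar > 0\<close>]
      \<comment> \<open>With \<open>\<kappa> \<ge> 0\<close> the payoff is nonnegative, and the
        strict bound above \<open>a\<close> makes it positive there, even if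
        \<open>\<kappa> = 0\<close>.\<close>
      proof (rule payoff_density_integral_pos[OF g_meas bound _ _ \<open>a > 0\<close> \<open>\<theta> > 0\<close> \<open>y_bar > 0\<close>])
        show "g x \<ge> 0" if "x > 0" for x
          using g_ge[OF that] mult_nonneg_nonneg[OF \<open>\<kappa> \<ge> 0\<close>, of x] that by linarith
        show "g x > 0" if "x > a" for x
          using g_large[OF that] mult_nonneg_nonneg[OF \<open>\<kappa> \<ge> 0\<close>, of x] that \<open>a > 0\<close> by linarith
      qed
      ultimately show False
        by simp
    qed
  qed
qed

end
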